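(* Let $n>1$ and let $V=(v_{i,j})$ be a real upper triangular $n\times n$ matrix with nonzero diagonal entries such that $v_{m,l}/v_{m,m}$ is rational for all $1\le m<l\le n$. Let $X_1,\dots,X_n$ be independent real-valued random variables, $X_m$ being observed at node $m$, and let $s(1),\dots,s(n-1)$ be the integers sent by the nodes under the protocol $\Pi_c$ (with $x_m=X_m$). Then the rate required to transmit $s(m)$, $m=1,2,\dots,n-1$, is no larger than $\sum_{i=1}^{n-1}\log_2(q_i)$ bits; that is, $$\sum_{m=1}^{n-1}H(s(m))\le\sum_{i=1}^{n-1}\log_2(q_i).$$
   Context: $[z]$ denotes the nearest integer to the real number $z$, with ties broken by the fixed convention $[z]=\lfloor z+\frac12\rfloor$. $H$ denotes Shannon entropy in bits; the rate required to transmit a discrete random variable $S$ (produced in an i.i.d. fashion over time) is $H(S)$. Protocol $\Pi_c$: for $l>m$ write $v_{m,l}/v_{m,m}=p_{m,l}/q_{m,l}$ with $p_{m,l},q_{m,l}$ relatively prime integers and $q_{m,l}>0$. Let $q_m=\mathrm{lcm}\{q_{m,l}:l>m\}$ for $m<n$, and $q_n=1$. Node $m$, observing $x_m$, sends to a fusion center $\tilde b_m=[x_m/v_{m,m}]$ and $s(m)$, where $s(m)$ is the largest $s\in\{0,1,\dots,q_m-1\}$ for which $[x_m/v_{m,m}-s/q_m]=[x_m/v_{m,m}]$ (so $s(n)=0$). *)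

theory Defs
  imports "HOL-Probability.Probability" "Jordan_Normal_Form.Matrix"
begin

text \<open>
  Matrix rows, columns and nodes are indexed by \<open>0, ..., n - 1\<close>, following the matrix library;
  the last node is thus \<open>n - 1\<close>. The library function \<^const>\<open>round\<close> is
  \<open>\<lambda>z. \<lfloor>z + 1/2\<rfloor>\<close>, i.e. the nearest integer with ties broken upwards.
\<close>

definition reduced_denom :: "real \<Rightarrow> nat" where
  "reduced_denom x =
     (THE q. q > 0 \<and> (\<exists>p::int. coprime p (int q) \<and> x = real_of_int p / real q))"

lemma reduced_denom_unique:
  assumes "x \<in> \<rat>"
  shows "\<exists>!q::nat. q > 0 \<and> (\<exists>p::int. coprime p (int q) \<and> x = real_of_int p / real q)"
proof -
  obtain r :: rat where r: "x = of_rat r"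
    using assms by (auto elim: Rats_cases)
  have rep: "x = real_of_int p / real q \<longleftrightarrow> r = Fract p (int q)" for p :: int and q :: nat
  proof -
    have "real_of_int p / real q = of_rat (Fract p (int q))"
      by (cases "q = 0") (simp_all add: of_rat_rat rat_number_collapse)
    then show ?thesis
      by (simp add: r)
  qed
  have ex1: "\<exists>!a. r = Fract (fst a) (snd a) \<and> snd a > 0 \<and> coprime (fst a) (snd a)"
    by (rule quotient_of_unique)
  then obtain a where a: "r = Fract (fst a) (snd a)" "snd a > 0" "coprime (fst a) (snd a)"
    by blast
  show ?thesis
  proof (rule ex1I[of _ "nat (snd a)"])
    show "nat (snd a) > 0 \<and>
        (\<exists>p::int. coprime p (int (nat (snd a))) \<and> x = real_of_int p / real (nat (snd a)))"
      unfolding rep using a by auto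
  next
    fix q :: nat
    assume "q > 0 \<and> (\<exists>p::int. coprime p (int q) \<and> x = real_of_int p / real q)"
    then obtain p where "q > 0" "coprime p (int q)" "r = Fract p (int q)"
      unfolding rep by blast
    then have "(p, int q) = a"
      using ex1 a by (metis fst_conv snd_conv of_nat_0_less_iff)
    then show "q = nat (snd a)"
      by auto
  qed
qed

text \<open>For the last node the set below is empty, so its value is \<open>Lcm {} = 1\<close>.\<close>

definition node_q :: "real mat \<Rightarrow> nat \<Rightarrow> nat" where
  "node_q V m =
     Lcm {reduced_denom (V $$ (m, l) / V $$ (m, m)) | l. m < l \<and> l < dim_col V}"

definition node_b :: "real mat \<Rightarrow> nat \<Rightarrow> real \<Rightarrow> int" where
  "node_b V m x = round (x / V $$ (m, m))"

definition node_s :: "real mat \<Rightarrow> nat \<Rightarrow> real \<Rightarrow> nat" where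
  "node_s V m x =
     Max {s. s < node_q V m \<and>
             round (x / V $$ (m, m) - real s / real (node_q V m)) = node_b V m x}"

text \<open>The reference measure is counting measure on the range of \<open>S\<close>, and base 2 gives bits.\<close>

definition shannon_entropy :: "'a measure \<Rightarrow> ('a \<Rightarrow> 'b) \<Rightarrow> real" where
  "shannon_entropy M S = prob_space.entropy M 2 (count_space (S ` space M)) S"

end

theory Submission
  imports Defs
begin

text \<open>The bound holds term by term. Rationality of the ratios makes q_m a least common
  multiple of finitely many positive denominators, hence positive (\<open>node_q_pos\<close>), so
  s(m) is well defined with values in {0, ..., q_m - 1} (\<open>node_s_less\<close>). It is a
  measurable function of X_m (\<open>measurable_node_s\<close>), and a random variable with at most
  q values has entropy at most log_2 q, the entropy of the uniform distribution on q values
  (\<open>shannon_entropy_le_log_bound\<close>).\<close>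

lemma reduced_denom_pos:
  assumes "x \<in> \<rat>"
  shows "reduced_denom x > 0"
  using theI'[OF reduced_denom_unique[OF assms]] unfolding reduced_denom_def by simp

lemma node_q_pos:
  assumes "\<And>l. m < l \<Longrightarrow> l < dim_col V \<Longrightarrow> V $$ (m, l) / V $$ (m, m) \<in> \<rat>"
  shows "node_q V m > 0"
proof -
  let ?A = "{reduced_denom (V $$ (m, l) / V $$ (m, m)) | l. m < l \<and> l < dim_col V}"
  have "finite ?A"
    by simp
  moreover have "0 \<notin> ?A"
  proof
    assume "0 \<in> ?A"
    then obtain l where "m < l" "l < dim_col V" "reduced_denom (V $$ (m, l) / V $$ (m, m)) = 0"
      by (elim CollectE exE conjE) simp
    then show False
      using reduced_denom_pos[OF assms, of l] by simp
  qed
  \<comment> \<open>On the naturals, the \<open>Lcm\<close> of a finite set vanishes only if 0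
    belongs to it; for the last node the set is empty and the value is 1.\<close>
  ultimately have "Lcm ?A \<noteq> 0"
    using Lcm_0_iff by blast
  then show ?thesis
    by (simp only: node_q_def neq0_conv)
qed

lemma node_s_less:
  assumes "node_q V m > 0"
  shows "node_s V m x < node_q V m"
proof -
  let ?S = "{s. s < node_q V m \<and>
    round (x / V $$ (m, m) - real s / real (node_q V m)) = node_b V m x}"
  \<comment> \<open>The shift s = 0 leaves the rounding unchanged, so the maximum is over a nonempty
    set; the bound by \<open>node_q V m\<close> makes the set finite.\<close>
  have "0 \<in> ?S"
    using assms by (simp add: node_b_def)
  then have "Max ?S \<in> ?S"
    by (intro Max_in) auto
  then show ?thesis
    by (simp add: node_s_def)
qed

lemma measurable_round [measurable]: "(round :: real \<Rightarrow> int) \<in> borel \<rightarrow>\<^sub>M count_space UNIV"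
  unfolding round_def by measurable

lemma measurable_node_s [measurable]: "node_s V m \<in> borel \<rightarrow>\<^sub>M count_space UNIV"
  unfolding node_s_def node_b_def by measurable

text \<open>Finite range and measurability make \<open>S\<close> a simple random variable, whose
  entropy is at most the logarithm of the number of values it attains; that number is at most
  \<open>q\<close>.\<close>

lemma shannon_entropy_le_log_bound:
  fixes S :: "'a \<Rightarrow> nat"
  assumes "prob_space M" and S: "S \<in> M \<rightarrow>\<^sub>M count_space UNIV"
    and bound: "\<And>\<omega>. \<omega> \<in> space M \<Longrightarrow> S \<omega> < q"
  shows "shannon_entropy M S \<le> log 2 (real q)"
proof -
  interpret prob_space M by fact
  interpret information_space M 2 by unfold_locales simp
  have range: "S ` space M \<subseteq> {..<q}"
    using bound by auto
  then have finite: "finite (S ` space M)"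
    using finite_subset by blast
  have "simple_function M S"
    unfolding simple_function_def using finite measurable_sets[OF S] by auto
  then have "simple_distributed M S (\<lambda>s. prob (S -` {s} \<inter> space M))"
    by (rule simple_distributedI) (auto simp: measure_nonneg)
  then have "entropy 2 (count_space (S ` space M)) S \<le> log 2 (card (S ` space M))"
    by (rule entropy_le_card)
  also have "\<dots> \<le> log 2 q"
  proof -
    \<comment> \<open>A probability space is nonempty, so the logarithm is taken at a positive
      number, where it is monotone.\<close>
    have "card (S ` space M) > 0"
      using finite not_empty by (simp add: card_gt_0_iff)
    moreover have "card (S ` space M) \<le> q"
      using card_mono[OF _ range] by simp
    ultimately show ?thesis
      by simp
  qed
  finally show ?thesis
    by (simp add: shannon_entropy_def)
qed

theorem corollary2:
  fixes n :: nat and V :: "real mat"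
    and M :: "'a measure" and X :: "nat \<Rightarrow> 'a \<Rightarrow> real"
  assumes "n > 1"
    and "V \<in> carrier_mat n n"
    and "upper_triangular V"
    and "\<And>m. m < n \<Longrightarrow> V $$ (m, m) \<noteq> 0"
    and "\<And>m l. m < l \<Longrightarrow> l < n \<Longrightarrow> V $$ (m, l) / V $$ (m, m) \<in> \<rat>"
    and "prob_space M"
    and "prob_space.indep_vars M (\<lambda>_. borel) X {..<n}"
  shows "(\<Sum>m<n - 1. shannon_entropy M (\<lambda>\<omega>. node_s V m (X m \<omega>)))
           \<le> (\<Sum>m<n - 1. log 2 (real (node_q V m)))"
proof (rule sum_mono)
  interpret prob_space M by fact
  fix m
  assume "m \<in> {..<n - 1}"
  \<comment> \<open>Measurability of each variable in the family is part of
    \<open>indep_vars\<close>.\<close>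
  then have [measurable]: "X m \<in> borel_measurable M"
    using assms(7) by (auto simp: indep_vars_def)
  have "node_q V m > 0"
    using assms(2,5) by (intro node_q_pos) auto
  then show "shannon_entropy M (\<lambda>\<omega>. node_s V m (X m \<omega>)) \<le> log 2 (real (node_q V m))"
    by (intro shannon_entropy_le_log_bound \<open>prob_space M\<close> node_s_less) simp
qed

end
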